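(* Let $k \ge 2$ be an integer, and let $G=(V,E)$ be a finite simple graph whose edges are each colored blue or red, such that every vertex in $V$ belongs to a monochromatic $k$-clique of each color (that is, every vertex lies in some $k$-clique all of whose edges are blue, and in some $k$-clique all of whose edges are red). Then $|V| \ge 4(k-1)$.
   Context: A $k$-clique is a set of $k$ pairwise adjacent vertices; it is monochromatic of a given color if all edges among its vertices have that color. *)

theory Defs
  imports "HOL-Library.Ramsey"
begin

datatype color = Blue | Red

definition k_clique :: "'a set \<Rightarrow> 'a set set \<Rightarrow> nat \<Rightarrow> 'a set \<Rightarrow> bool" where
  "k_clique V E k K \<longleftrightarrow> K \<in> [V]\<^bsup>k\<^esup> \<and> clique K E"

definition mono_clique ::
  "'a set \<Rightarrow> 'a set set \<Rightarrow> ('a set \<Rightarrow> color) \<Rightarrow> color \<Rightarrow> nat \<Rightarrow> 'a set \<Rightarrow> bool" where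
  "mono_clique V E col c k K \<longleftrightarrow> k_clique V E k K \<and> (\<forall>e \<in> [K]\<^bsup>2\<^esup>. col e = c)"

end

theory Submission
  imports Defs Complex_Main
begin

text \<open>
  A blue and a red clique share at most one vertex. Starting from a single clique, keep adding
  a clique of the missing colour at a vertex covered in one colour only; each step doubly covers
  at least one new vertex, so this ends with \<open>p\<close> blue \<open>k\<close>-cliques and \<open>q\<close> red \<open>l\<close>-cliques that
  cover the same set \<open>W\<close> of \<open>n\<close> vertices and satisfy \<open>p + q \<le> n + 1\<close>. If \<open>f v, g v \<ge> 1\<close> count
  the chosen blue and red cliques through \<open>v\<close>, summing \<open>(f v - 1) (g v - 1) \<ge> 0\<close> over \<open>W\<close> gives
  \<open>n \<ge> k p + l q - p q = k l - (p - l) (q - k)\<close>. A red clique meets each of the \<open>p\<close> blue ones at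
  most once, so \<open>p \<ge> l\<close>, and likewise \<open>q \<ge> k\<close>. Hence the last product is at most
  \<open>((n + 1 - k - l) / 2)\<^sup>2\<close>; the resulting quadratic inequality for \<open>n\<close> gives
  \<open>n + 3 \<ge> k + l + 2 \<surd>((k - 1) (l - 1) + 1)\<close>, and for \<open>k = l\<close> the root exceeds \<open>k - 1\<close>.
\<close>

definition cross_linear :: "'a set set \<Rightarrow> 'a set set \<Rightarrow> bool" where
  "cross_linear \<A> \<B> \<longleftrightarrow> (\<forall>A\<in>\<A>. \<forall>B\<in>\<B>. card (A \<inter> B) \<le> 1)"

lemma cross_linear_commute: "cross_linear \<A> \<B> \<longleftrightarrow> cross_linear \<B> \<A>"
  unfolding cross_linear_def by (metis Int_commute)

lemma cross_linear_subset:
  assumes "cross_linear \<A> \<B>" "\<F> \<subseteq> \<A>" "\<G> \<subseteq> \<B>"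
  shows "cross_linear \<F> \<G>"
  using assms unfolding cross_linear_def by blast

lemma cross_linear_card_le_card_cover:
  assumes "cross_linear \<F> \<G>" "finite \<F>" "B \<in> \<G>" "B \<subseteq> \<Union>\<F>"
  shows "card B \<le> card \<F>"
proof -
  have "B = (\<Union>A\<in>\<F>. A \<inter> B)" using \<open>B \<subseteq> \<Union>\<F>\<close> by blast
  then have "card B \<le> (\<Sum>A\<in>\<F>. card (A \<inter> B))" using card_UN_le[OF \<open>finite \<F>\<close>] by metis
  also have "\<dots> \<le> (\<Sum>A\<in>\<F>. 1)"
    using assms(1,3) by (intro sum_mono) (simp add: cross_linear_def)
  finally show ?thesis by simp
qed

definition degree :: "'a set set \<Rightarrow> 'a \<Rightarrow> nat" where
  "degree \<F> v = card {A \<in> \<F>. v \<in> A}"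

lemma degree_pos:
  assumes "finite \<F>" "v \<in> \<Union>\<F>"
  shows "0 < degree \<F> v"
  using assms by (auto simp: degree_def card_gt_0_iff)

lemma sum_degree:
  assumes "finite W" "\<Union>\<F> \<subseteq> W"
  shows "(\<Sum>v\<in>W. degree \<F> v) = (\<Sum>A\<in>\<F>. card A)"
  unfolding degree_def
proof (rule sum_multicount_gen)
  show "finite \<F>" using assms finite_subset finite_UnionD by blast
  have "{v \<in> W. v \<in> A} = A" if "A \<in> \<F>" for A using that assms(2) by blast
  then show "\<forall>A\<in>\<F>. card {v \<in> W. v \<in> A} = card A" by simp
qed fact

lemma sum_degree_mult_degree:
  assumes "finite W" "\<Union>\<F> \<subseteq> W" "\<Union>\<G> \<subseteq> W"
  shows "(\<Sum>v\<in>W. degree \<F> v * degree \<G> v) = (\<Sum>(A, B)\<in>\<F> \<times> \<G>. card (A \<inter> B))"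
proof -
  have "degree \<F> v * degree \<G> v = card {P \<in> \<F> \<times> \<G>. v \<in> fst P \<inter> snd P}" for v
  proof -
    have "{A \<in> \<F>. v \<in> A} \<times> {B \<in> \<G>. v \<in> B} = {P \<in> \<F> \<times> \<G>. v \<in> fst P \<inter> snd P}" by auto
    then show ?thesis by (metis degree_def card_cartesian_product)
  qed
  then have "(\<Sum>v\<in>W. degree \<F> v * degree \<G> v)
      = (\<Sum>v\<in>W. card {P \<in> \<F> \<times> \<G>. v \<in> fst P \<inter> snd P})"
    by simp
  also have "\<dots> = (\<Sum>P\<in>\<F> \<times> \<G>. card (fst P \<inter> snd P))"
  proof (rule sum_multicount_gen)
    show "finite (\<F> \<times> \<G>)" using assms finite_subset finite_UnionD by blast
    have "{v \<in> W. v \<in> fst P \<inter> snd P} = fst P \<inter> snd P" if "P \<in> \<F> \<times> \<G>" for P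
      using that assms(2) by fastforce
    then show "\<forall>P\<in>\<F> \<times> \<G>. card {v \<in> W. v \<in> fst P \<inter> snd P} = card (fst P \<inter> snd P)" by simp
  qed fact
  finally show ?thesis by (simp add: case_prod_beta)
qed

lemma cross_linear_covers_sum_card_le:
  assumes "finite W" "\<Union>\<F> = W" "\<Union>\<G> = W" "cross_linear \<F> \<G>"
  shows "(\<Sum>A\<in>\<F>. card A) + (\<Sum>B\<in>\<G>. card B) \<le> card W + card \<F> * card \<G>"
proof -
  have fin: "finite \<F>" "finite \<G>" using assms(1-3) finite_UnionD by metis+
  have "degree \<F> v + degree \<G> v \<le> 1 + degree \<F> v * degree \<G> v" if "v \<in> W" for v
  proof -
    have "0 < degree \<F> v" "0 < degree \<G> v" using that assms(2,3) fin degree_pos by metis+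
    then obtain i j where "degree \<F> v = Suc i" "degree \<G> v = Suc j" by (metis gr0_conv_Suc)
    then show ?thesis by simp
  qed
  then have "(\<Sum>v\<in>W. degree \<F> v + degree \<G> v) \<le> (\<Sum>v\<in>W. 1 + degree \<F> v * degree \<G> v)"
    by (rule sum_mono)
  then have "(\<Sum>v\<in>W. degree \<F> v) + (\<Sum>v\<in>W. degree \<G> v)
      \<le> card W + (\<Sum>v\<in>W. degree \<F> v * degree \<G> v)"
    by (simp only: sum.distrib card_eq_sum)
  then have "(\<Sum>A\<in>\<F>. card A) + (\<Sum>B\<in>\<G>. card B)
      \<le> card W + (\<Sum>(A, B)\<in>\<F> \<times> \<G>. card (A \<inter> B))"
    using assms(1-3) by (simp add: sum_degree sum_degree_mult_degree)
  also have "(\<Sum>(A, B)\<in>\<F> \<times> \<G>. card (A \<inter> B)) \<le> (\<Sum>(A, B)\<in>\<F> \<times> \<G>. 1)"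
    using assms(4) by (intro sum_mono) (auto simp: cross_linear_def)
  also have "\<dots> = card \<F> * card \<G>" by (simp add: card_cartesian_product)
  finally show ?thesis by simp
qed

lemma cross_linear_covers_mult_card_le:
  assumes "finite W" "\<Union>\<F> = W" "\<Union>\<G> = W" "cross_linear \<F> \<G>"
    and "\<And>A. A \<in> \<F> \<Longrightarrow> k \<le> card A" "\<And>B. B \<in> \<G> \<Longrightarrow> l \<le> card B"
  shows "k * card \<F> + l * card \<G> \<le> card W + card \<F> * card \<G>"
proof -
  have "k * card \<F> + l * card \<G> \<le> (\<Sum>A\<in>\<F>. card A) + (\<Sum>B\<in>\<G>. card B)"
    using sum_bounded_below[of \<F> k card] sum_bounded_below[of \<G> l card] assms(5,6)
    by (simp add: mult.commute add_mono)
  also have "\<dots> \<le> card W + card \<F> * card \<G>"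
    using assms(1-4) by (rule cross_linear_covers_sum_card_le)
  finally show ?thesis .
qed

definition economical :: "'a set set \<Rightarrow> 'a set set \<Rightarrow> bool" where
  "economical \<F> \<G> \<longleftrightarrow> card \<F> + card \<G> \<le> card (\<Union>\<F> \<inter> \<Union>\<G>) + 1"

lemma economical_commute: "economical \<F> \<G> \<longleftrightarrow> economical \<G> \<F>"
  by (simp add: economical_def Int_commute add.commute)

lemma economical_insert:
  assumes "economical \<F> \<G>" "finite (\<Union>\<F>)" "v \<in> \<Union>\<F>" "v \<notin> \<Union>\<G>" "v \<in> B"
  shows "economical \<F> (insert B \<G>)"
proof -
  have "Suc (card (\<Union>\<F> \<inter> \<Union>\<G>)) = card (insert v (\<Union>\<F> \<inter> \<Union>\<G>))"
    using assms(2,4) by simp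
  also have "\<dots> \<le> card (\<Union>\<F> \<inter> \<Union>(insert B \<G>))"
    using assms(2,3,5) by (intro card_mono) auto
  finally show ?thesis
    using assms(1) card_insert_le_m1[of "Suc (card \<G>)" \<G> B] by (simp add: economical_def)
qed

lemma Union_subset_if_economical_maximal:
  assumes "economical \<F> \<G>" "finite (\<Union>\<F>)" "\<Union>\<F> \<subseteq> \<Union>\<B>"
    and maximal: "\<And>B. B \<in> \<B> \<Longrightarrow> economical \<F> (insert B \<G>) \<Longrightarrow> B \<in> \<G>"
  shows "\<Union>\<F> \<subseteq> \<Union>\<G>"
proof (rule subsetI, rule ccontr)
  fix v assume v: "v \<in> \<Union>\<F>" "v \<notin> \<Union>\<G>"
  then obtain B where B: "B \<in> \<B>" "v \<in> B" using assms(3) by blast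
  then have "economical \<F> (insert B \<G>)" using economical_insert assms(1,2) v by metis
  then show False using maximal B v(2) by blast
qed

lemma ex_maximal_economical_subfamilies:
  assumes "finite \<A>" "finite \<B>" "A \<in> \<A>"
  obtains \<F> \<G> where "\<F> \<subseteq> \<A>" "\<G> \<subseteq> \<B>" "A \<in> \<F>" "economical \<F> \<G>"
    "\<And>B. B \<in> \<B> \<Longrightarrow> economical \<F> (insert B \<G>) \<Longrightarrow> B \<in> \<G>"
    "\<And>B. B \<in> \<A> \<Longrightarrow> economical (insert B \<F>) \<G> \<Longrightarrow> B \<in> \<F>"
proof -
  define admissible where "admissible = (\<lambda>(\<F>, \<G>).
    \<F> \<subseteq> \<A> \<and> \<G> \<subseteq> \<B> \<and> A \<in> \<F> \<and> economical \<F> \<G>)"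
  define total where "total = (\<lambda>(\<F> :: 'a set set, \<G> :: 'a set set). card \<F> + card \<G>)"
  have "admissible ({A}, {})" using assms(3) by (simp add: admissible_def economical_def)
  moreover have "\<forall>P. admissible P \<longrightarrow> total P < card \<A> + card \<B> + 1"
    using assms(1,2)
    by (auto simp: admissible_def total_def less_Suc_eq_le intro!: add_mono card_mono)
  ultimately obtain \<F> \<G> where adm: "admissible (\<F>, \<G>)"
    and greatest: "\<And>P. admissible P \<Longrightarrow> total P \<le> total (\<F>, \<G>)"
    using ex_has_greatest_nat[of admissible _ total] by (metis surj_pair)
  have sub: "\<F> \<subseteq> \<A>" "\<G> \<subseteq> \<B>" and A: "A \<in> \<F>" and eco: "economical \<F> \<G>"
    using adm by (auto simp: admissible_def)
  have fin: "finite \<F>" "finite \<G>" using sub assms(1,2) finite_subset by blast+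
  show thesis
  proof (rule that[OF sub A eco])
    fix B assume "B \<in> \<B>" "economical \<F> (insert B \<G>)"
    then have "admissible (\<F>, insert B \<G>)" using sub A by (simp add: admissible_def)
    then have "total (\<F>, insert B \<G>) \<le> total (\<F>, \<G>)" by (rule greatest)
    then show "B \<in> \<G>" using fin by (simp add: total_def card_insert_if split: if_splits)
  next
    fix B assume "B \<in> \<A>" "economical (insert B \<F>) \<G>"
    then have "admissible (insert B \<F>, \<G>)" using sub A by (simp add: admissible_def)
    then have "total (insert B \<F>, \<G>) \<le> total (\<F>, \<G>)" by (rule greatest)
    then show "B \<in> \<F>" using fin by (simp add: total_def card_insert_if split: if_splits)
  qed
qed

lemma ex_economical_subfamilies_same_Union:
  assumes "finite (\<Union>\<A>)" "\<Union>\<A> = \<Union>\<B>" "A \<in> \<A>"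
  obtains \<F> \<G> where "\<F> \<subseteq> \<A>" "\<G> \<subseteq> \<B>" "A \<in> \<F>" "\<Union>\<F> = \<Union>\<G>" "economical \<F> \<G>"
proof -
  have "finite \<A>" "finite \<B>" using assms(1,2) finite_UnionD by metis+
  then obtain \<F> \<G> where sub: "\<F> \<subseteq> \<A>" "\<G> \<subseteq> \<B>" and A: "A \<in> \<F>" and eco: "economical \<F> \<G>"
    and maximal_\<G>: "\<And>B. B \<in> \<B> \<Longrightarrow> economical \<F> (insert B \<G>) \<Longrightarrow> B \<in> \<G>"
    and maximal_\<F>: "\<And>B. B \<in> \<A> \<Longrightarrow> economical (insert B \<F>) \<G> \<Longrightarrow> B \<in> \<F>"
    using ex_maximal_economical_subfamilies[of \<A> \<B> A] assms(3) by metis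
  have Unions: "\<Union>\<F> \<subseteq> \<Union>\<B>" "\<Union>\<G> \<subseteq> \<Union>\<A>" using sub assms(2) by blast+
  then have fin: "finite (\<Union>\<F>)" "finite (\<Union>\<G>)" using assms(1,2) finite_subset by metis+
  have "\<Union>\<F> \<subseteq> \<Union>\<G>"
    using eco fin(1) Unions(1) maximal_\<G> by (rule Union_subset_if_economical_maximal)
  moreover have "\<Union>\<G> \<subseteq> \<Union>\<F>"
    using eco[unfolded economical_commute[of \<F>]] fin(2) Unions(2)
      maximal_\<F>[unfolded economical_commute[of _ \<G>]]
    by (rule Union_subset_if_economical_maximal)
  ultimately show thesis using that sub A eco by blast
qed

lemma sqrt_bound_if_cover_counts:
  fixes k l n p q :: real
  assumes "l \<le> p" "k \<le> q" "p + q \<le> n + 1" "k * p + l * q \<le> n + p * q"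
  shows "k + l + 2 * sqrt ((k - 1) * (l - 1) + 1) \<le> n + 3"
proof -
  define m where "m = n + 1 - k - l"
  have "4 * ((p - l) * (q - k)) \<le> ((p - l) + (q - k))\<^sup>2"
    using zero_le_power2[of "(p - l) - (q - k)"] by (simp add: power2_eq_square algebra_simps)
  also have "\<dots> \<le> m\<^sup>2" unfolding m_def by (rule power_mono) (use assms(1-3) in linarith)+
  finally have "4 * (k * l - n) \<le> m\<^sup>2" using assms(4) by (simp add: algebra_simps)
  then have "(k - 1) * (l - 1) + 1 \<le> (m / 2 + 1)\<^sup>2"
    by (simp add: m_def power2_eq_square field_simps)
  moreover have "0 \<le> m / 2 + 1" using assms(1-3) by (simp add: m_def)
  ultimately have "sqrt ((k - 1) * (l - 1) + 1) \<le> m / 2 + 1" by (intro real_le_lsqrt)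
  then show ?thesis by (simp add: m_def field_simps)
qed

lemma cross_linear_covers_card_ge:
  fixes k l :: nat
  assumes "finite V" "V \<noteq> {}" "\<Union>\<A> = V" "\<Union>\<B> = V" "cross_linear \<A> \<B>"
    and card_\<A>: "\<And>A. A \<in> \<A> \<Longrightarrow> k \<le> card A" and card_\<B>: "\<And>B. B \<in> \<B> \<Longrightarrow> l \<le> card B"
  shows "real k + real l + 2 * sqrt ((real k - 1) * (real l - 1) + 1) \<le> real (card V) + 3"
proof -
  obtain v A where A: "A \<in> \<A>" "v \<in> A" using assms(2,3) by blast
  moreover have "finite (\<Union>\<A>)" "\<Union>\<A> = \<Union>\<B>" using assms(1,3,4) by simp_all
  ultimately obtain \<F> \<G> where sub: "\<F> \<subseteq> \<A>" "\<G> \<subseteq> \<B>" and "A \<in> \<F>"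
    and U: "\<Union>\<F> = \<Union>\<G>" and eco: "economical \<F> \<G>"
    by (metis ex_economical_subfamilies_same_Union)
  then obtain B where "B \<in> \<G>" using A(2) by blast
  have W: "\<Union>\<F> \<subseteq> V" using sub(1) assms(3) by blast
  then have finW: "finite (\<Union>\<F>)" using assms(1) finite_subset by blast
  then have fin: "finite \<F>" "finite \<G>" using U finite_UnionD by metis+
  have linear: "cross_linear \<F> \<G>" using assms(5) sub by (rule cross_linear_subset)
  have card_W: "card (\<Union>\<F>) \<le> card V" using assms(1) W by (rule card_mono)
  have "card B \<le> card \<F>"
    by (rule cross_linear_card_le_card_cover[OF linear fin(1) \<open>B \<in> \<G>\<close>]) (use U \<open>B \<in> \<G>\<close> in blast)
  then have "l \<le> card \<F>" using card_\<B> sub(2) \<open>B \<in> \<G>\<close> by fastforce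
  moreover have "card A \<le> card \<G>"
    by (rule cross_linear_card_le_card_cover[OF _ fin(2) \<open>A \<in> \<F>\<close>])
      (use linear cross_linear_commute U \<open>A \<in> \<F>\<close> in blast)+
  then have "k \<le> card \<G>" using card_\<A> A(1) by fastforce
  moreover have "card \<F> + card \<G> \<le> card V + 1" using eco U card_W by (simp add: economical_def)
  moreover have "k * card \<F> + l * card \<G> \<le> card V + card \<F> * card \<G>"
    using cross_linear_covers_mult_card_le[OF finW refl U[symmetric] linear]
      card_\<A> card_\<B> sub card_W
    by (meson add_le_mono1 order_trans subsetD)
  then have "real k * card \<F> + real l * card \<G> \<le> real (card V) + real (card \<F>) * card \<G>"
    by (metis of_nat_add of_nat_le_iff of_nat_mult)
  ultimately show ?thesis by (intro sqrt_bound_if_cover_counts) simp_all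
qed

lemma cross_linear_mono_cliques:
  assumes "c \<noteq> d"
  shows "cross_linear {K. mono_clique V E col c k K} {K. mono_clique V E col d l K}"
  unfolding cross_linear_def
proof (intro ballI)
  fix A B
  assume "A \<in> {K. mono_clique V E col c k K}" "B \<in> {K. mono_clique V E col d l K}"
  then have A: "finite A" "\<forall>e\<in>[A]\<^bsup>2\<^esup>. col e = c" and B: "\<forall>e\<in>[B]\<^bsup>2\<^esup>. col e = d"
    by (auto simp: mono_clique_def k_clique_def nsets_def)
  have "u = v" if "u \<in> A \<inter> B" "v \<in> A \<inter> B" for u v
  proof (rule ccontr)
    assume "u \<noteq> v"
    then have "{u, v} \<in> [A]\<^bsup>2\<^esup>" "{u, v} \<in> [B]\<^bsup>2\<^esup>" using that by (auto simp: nsets_def)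
    then show False using A(2) B assms by metis
  qed
  then show "card (A \<inter> B) \<le> 1" using A(1) by (simp add: card_le_Suc0_iff_eq)
qed

lemma mono_clique_covers_card_ge:
  assumes "finite V" "V \<noteq> {}" "c \<noteq> d"
    and "\<And>v. v \<in> V \<Longrightarrow> \<exists>K. mono_clique V E col c k K \<and> v \<in> K"
    and "\<And>v. v \<in> V \<Longrightarrow> \<exists>K. mono_clique V E col d l K \<and> v \<in> K"
  shows "real k + real l + 2 * sqrt ((real k - 1) * (real l - 1) + 1) \<le> real (card V) + 3"
proof (rule cross_linear_covers_card_ge)
  have clique: "K \<subseteq> V" "card K = j" if "mono_clique V E col a j K" for a j K
    using that by (auto simp: mono_clique_def k_clique_def nsets_def)
  show "\<Union>{K. mono_clique V E col c k K} = V" "\<Union>{K. mono_clique V E col d l K} = V"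
    using clique(1) assms(4,5) by blast+
  show "k \<le> card K" if "K \<in> {K. mono_clique V E col c k K}" for K using that clique(2) by simp
  show "l \<le> card K" if "K \<in> {K. mono_clique V E col d l K}" for K using that clique(2) by simp
qed (use assms(1-3) in \<open>simp_all add: cross_linear_mono_cliques\<close>)

theorem theorem1:
  fixes V :: "'a set" and E :: "'a set set" and col :: "'a set \<Rightarrow> color" and k :: nat
  assumes "k \<ge> 2"
    and "finite V" and "V \<noteq> {}"
    and "E \<subseteq> [V]\<^bsup>2\<^esup>"
    and "\<forall>v\<in>V. \<forall>c. \<exists>K. mono_clique V E col c k K \<and> v \<in> K"
  shows "card V \<ge> 4 * (k - 1)"
proof -
  have "real k + real k + 2 * sqrt ((real k - 1) * (real k - 1) + 1) \<le> real (card V) + 3"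
    by (rule mono_clique_covers_card_ge[where c = Blue and d = Red]) (use assms(2,3,5) in auto)
  moreover have "real k - 1 < sqrt ((real k - 1) * (real k - 1) + 1)"
    by (rule real_less_rsqrt) (simp add: power2_eq_square)
  ultimately have "real (4 * k) < real (card V + 5)" by simp
  then show ?thesis by linarith
qed

end
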